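(* For integers $n\ge 1$ and $0\le k\le n-1$, $$\sum_{\sigma\in S_n}\prod_{i=1}^n [\ell_k(i;\sigma)]_q = \sum_{p\in PF_{n,k}} q^{\mathtt{area}_k(p)}.$$
   Context: Write $[n]=\{1,\dots,n\}$. A street has parking spots $1,\dots,n$ in order, and cars $c_1,\dots,c_n$ arrive in this order. A parking preference is a tuple $\alpha=(a_1,\dots,a_n)\in[n]^n$, where $a_i$ is the preferred spot of $c_i$. $k$-Naples parking rule: car $c_i$ drives to spot $a_i$; if it is empty, $c_i$ parks there. If it is occupied, $c_i$ backs up one spot at a time, checking spots $a_i-1,a_i-2,\dots$ in turn, up to at most $k$ spots behind $a_i$ (and never past spot $1$), and parks in the first empty one it finds. If all of these spots are occupied, $c_i$ goes forward and parks in the first empty spot after $a_i$, if there is one; otherwise it fails to park. The preference $\alpha$ is a $k$-Naples parking function of length $n$ if all $n$ cars park under this rule; $PF_{n,k}$ is the set of all of these. $S_n$ is the symmetric group on $[n]$, with permutations in one-line notation. The map $\varphi_k:PF_{n,k}\to S_n$ sends $\alpha$ to $s_1s_2\cdots s_n$, where spot $i$ is occupied by car $c_{s_i}$ after all cars have parked under the $k$-Naples rule. For $\sigma=s_1\cdots s_n\in S_n$ and $1\le i\le n$ (subsequences here are blocks of consecutive entries): - $\mathtt{left}_k(i;\sigma)$ is the length of the longest subsequence $s_j\cdots s_{i-1}$ such that $s_t<s_i$ for all $j\le t<i$ (equal to $0$ if it is empty). - $\mathtt{right}_k(i;\sigma)$ is the length of the longest subsequence $s_i\cdots s_r$ such that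 $r\le i+k$ (and $r\le n$) and $s_t\le s_i$ for all $i\le t\le r$. - $\ell_k(i;\sigma)=\mathtt{left}_k(i;\sigma)+\mathtt{right}_k(i;\sigma)$ if $\mathtt{left}_k(i;\sigma)=i-1$, and $\ell_k(i;\sigma)=\max(\mathtt{left}_k(i;\sigma)-k,0)+\mathtt{right}_k(i;\sigma)$ if $\mathtt{left}_k(i;\sigma)<i-1$. The $k$-Naples area of $\alpha=(a_1,\dots,a_n)\in PF_{n,k}$ is $$\mathtt{area}_k(\alpha)=\sum_{i=1}^n\left[n-i+\mathtt{right}_k(i;\varphi_k(\alpha))-a_i\right].$$ For a positive integer $m$, $[m]_q=1+q+\cdots+q^{m-1}$, where $q$ is an indeterminate. *)

theory Defs
  imports
    "HOL-Library.FuncSet"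
    "HOL-Combinatorics.Permutations"
    "HOL-Computational_Algebra.Formal_Laurent_Series"
begin

definition parking_preferences :: "nat \<Rightarrow> (nat \<Rightarrow> nat) set" where
  "parking_preferences n = {1..n} \<rightarrow>\<^sub>E {1..n}"

(* The spot taken by a car with preference a when the spots in occ are occupied.
   Backing up takes the first empty spot met while going down from a - 1, i.e. the largest empty
   spot s with 1 \<le> s and a - k \<le> s < a; going forward takes the smallest empty spot after a. *)
definition naples_spot :: "nat \<Rightarrow> nat \<Rightarrow> nat set \<Rightarrow> nat \<Rightarrow> nat option" where
  "naples_spot n k occ a =
     (let back = {s. 1 \<le> s \<and> s < a \<and> a \<le> s + k \<and> s \<notin> occ};
          forw = {s. a < s \<and> s \<le> n \<and> s \<notin> occ}
      in if a \<notin> occ then Some a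
         else if back \<noteq> {} then Some (Max back)
         else if forw \<noteq> {} then Some (Min forw)
         else None)"

(* State of the street after cars 1, ..., i have arrived: maps each occupied spot to its car.
   A car that fails to park leaves the street unchanged. *)
primrec naples_street :: "nat \<Rightarrow> nat \<Rightarrow> (nat \<Rightarrow> nat) \<Rightarrow> nat \<Rightarrow> (nat \<rightharpoonup> nat)" where
  "naples_street n k \<alpha> 0 = Map.empty"
| "naples_street n k \<alpha> (Suc i) =
     (let st = naples_street n k \<alpha> i
      in case naples_spot n k (dom st) (\<alpha> (Suc i)) of
           None \<Rightarrow> st
         | Some s \<Rightarrow> st(s \<mapsto> Suc i))"

definition PF :: "nat \<Rightarrow> nat \<Rightarrow> (nat \<Rightarrow> nat) set" where
  "PF n k = {\<alpha> \<in> parking_preferences n. \<forall>i\<in>{1..n}. \<exists>s. naples_street n k \<alpha> n s = Some i}"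

(* A permutation s_1 ... s_n is a function with value s_i at i that fixes everything outside
   {1..n}, as in the library's permutes. On PF n k the spots 1, ..., n are all occupied, so
   the None case only concerns points outside {1..n}. *)
definition naples_outcome :: "nat \<Rightarrow> nat \<Rightarrow> (nat \<Rightarrow> nat) \<Rightarrow> nat \<Rightarrow> nat" where
  "naples_outcome n k \<alpha> i =
     (case naples_street n k \<alpha> n i of Some c \<Rightarrow> c | None \<Rightarrow> i)"

(* Independent of k. The choice j = i is the empty block. *)
definition left_len :: "nat \<Rightarrow> (nat \<Rightarrow> nat) \<Rightarrow> nat" where
  "left_len i \<sigma> = Max {i - j | j. 1 \<le> j \<and> j \<le> i \<and> (\<forall>t. j \<le> t \<and> t < i \<longrightarrow> \<sigma> t < \<sigma> i)}"

definition right_len :: "nat \<Rightarrow> nat \<Rightarrow> nat \<Rightarrow> (nat \<Rightarrow> nat) \<Rightarrow> nat" where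
  "right_len n k i \<sigma> =
     Max {r - i + 1 | r. i \<le> r \<and> r \<le> i + k \<and> r \<le> n \<and> (\<forall>t. i \<le> t \<and> t \<le> r \<longrightarrow> \<sigma> t \<le> \<sigma> i)}"

(* The truncated subtraction on nat is max (left - k) 0. *)
definition ell :: "nat \<Rightarrow> nat \<Rightarrow> nat \<Rightarrow> (nat \<Rightarrow> nat) \<Rightarrow> nat" where
  "ell n k i \<sigma> =
     (if left_len i \<sigma> = i - 1 then left_len i \<sigma> + right_len n k i \<sigma>
      else (left_len i \<sigma> - k) + right_len n k i \<sigma>)"

definition naples_area :: "nat \<Rightarrow> nat \<Rightarrow> (nat \<Rightarrow> nat) \<Rightarrow> int" where
  "naples_area n k \<alpha> =
     (\<Sum>i=1..n. int n - int i + int (right_len n k i (naples_outcome n k \<alpha>)) - int (\<alpha> i))"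

(* The indeterminate q is fls_X in the formal Laurent series over the integers; this ring contains
   the integer polynomials in q, and q to the integer power area makes sense there without
   assuming that the area is nonnegative. *)
definition q_int :: "nat \<Rightarrow> int fls" where
  "q_int m = (\<Sum>j<m. fls_X ^ j)"

end

theory Submission
  imports Defs
begin

text \<open>
  Given the outcome \<open>\<sigma>\<close>, the spots occupied when car \<open>\<sigma> i\<close> arrives are those \<open>t\<close> with \<open>\<sigma> t < \<sigma> i\<close>,
  so the cars choose independently among the preferences that lead them to their spots. The
  preferences leading to spot \<open>i\<close> form an interval of length \<open>ell n k i \<sigma>\<close> with maximum
  \<open>i + right_len n k i \<sigma> - 1\<close>. Since the sums of \<open>n - i\<close> and of \<open>i - 1\<close> over \<open>{1..n}\<close> agree, the area
  adds up the distances of the preferences from these maxima, and each fibre contributes a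
  product of \<open>q\<close>-integers.
\<close>

section \<open>The parking rule for one car\<close>

text \<open>Trades \<open>Max\<close> and \<open>Min\<close> for conditions that intervals of spots
  are occupied. Both intervals contain \<open>a\<close>, so they also encode that the preferred spot
  is taken. Going forward to \<open>s\<close> requires the whole failed backward search and the
  spots from \<open>a\<close> up to \<open>s\<close> to be occupied; these merge into one interval,
  cut off at spot 1.\<close>

lemma naples_spot_eq_Some_iff:
  assumes "1 \<le> a"
  shows "naples_spot n k occ a = Some s \<longleftrightarrow>
    s \<notin> occ \<and> (s = a
      \<or> 1 \<le> s \<and> s < a \<and> a \<le> s + k \<and> {s<..a} \<subseteq> occ
      \<or> a < s \<and> s \<le> n \<and> {max 1 (a - k)..<s} \<subseteq> occ)"
proof -
  define behind where "behind = {s. 1 \<le> s \<and> s < a \<and> a \<le> s + k \<and> s \<notin> occ}"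
  define ahead where "ahead = {s. a < s \<and> s \<le> n \<and> s \<notin> occ}"
  have fin: "finite behind" "finite ahead"
    by (auto simp: behind_def ahead_def)
  have spot: "naples_spot n k occ a = (if a \<notin> occ then Some a
      else if behind \<noteq> {} then Some (Max behind)
      else if ahead \<noteq> {} then Some (Min ahead) else None)"
    unfolding naples_spot_def behind_def ahead_def Let_def ..
  consider "a \<notin> occ" | "a \<in> occ" "behind \<noteq> {}" | "a \<in> occ" "behind = {}"
    by blast
  then show ?thesis
  proof cases
    case 1
    have "\<not> {s<..a} \<subseteq> occ" if "s < a" using 1 that by auto
    moreover have "\<not> {max 1 (a - k)..<s} \<subseteq> occ" if "a < s"
    proof
      assume "{max 1 (a - k)..<s} \<subseteq> occ"
      moreover have "a \<in> {max 1 (a - k)..<s}" using that assms by simp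
      ultimately show False using 1 by blast
    qed
    ultimately show ?thesis using 1 unfolding spot by auto
  next
    case 2
    have "\<not> {max 1 (a - k)..<s} \<subseteq> occ" if "a < s"
    proof
      assume *: "{max 1 (a - k)..<s} \<subseteq> occ"
      obtain t where t: "1 \<le> t" "t < a" "a \<le> t + k" "t \<notin> occ"
        using 2(2) by (auto simp: behind_def)
      \<comment> \<open>An empty spot within backing distance lies in the forward interval, which
        rules out going forward.\<close>
      then have "t \<in> {max 1 (a - k)..<s}" using that by auto
      with * t(4) show False by blast
    qed
    moreover have "Max behind = s \<longleftrightarrow> s \<in> behind \<and> (\<forall>t\<in>behind. t \<le> s)"
      using fin(1) 2(2) by (simp add: Max_eq_iff)
    moreover have "s \<in> behind \<and> (\<forall>t\<in>behind. t \<le> s) \<longleftrightarrow>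
        s \<notin> occ \<and> 1 \<le> s \<and> s < a \<and> a \<le> s + k \<and> {s<..a} \<subseteq> occ"
    proof (intro iffI conjI)
      assume s: "s \<in> behind \<and> (\<forall>t\<in>behind. t \<le> s)"
      show "{s<..a} \<subseteq> occ"
      proof
        fix t assume t: "t \<in> {s<..a}"
        show "t \<in> occ"
        proof (rule ccontr)
          assume "t \<notin> occ"
          with t 2(1) s have "t \<in> behind" by (cases "t = a") (auto simp: behind_def)
          with s t show False by auto
        qed
      qed
    next
      assume s: "s \<notin> occ \<and> 1 \<le> s \<and> s < a \<and> a \<le> s + k \<and> {s<..a} \<subseteq> occ"
      then show "\<forall>t\<in>behind. t \<le> s"
        by (auto simp: behind_def subset_iff) (meson less_imp_le not_le)
    qed (auto simp: behind_def)
    ultimately show ?thesis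
      using 2 unfolding spot by auto
  next
    case 3
    have "\<not> (s \<notin> occ \<and> 1 \<le> s \<and> s < a \<and> a \<le> s + k)"
      using 3(2) by (auto simp: behind_def)
    moreover have "ahead \<noteq> {} \<and> Min ahead = s \<longleftrightarrow> s \<in> ahead \<and> (\<forall>t\<in>ahead. s \<le> t)"
      using fin(2) by (metis Min_eq_iff empty_iff)
    moreover have "s \<in> ahead \<and> (\<forall>t\<in>ahead. s \<le> t) \<longleftrightarrow>
        s \<notin> occ \<and> a < s \<and> s \<le> n \<and> {max 1 (a - k)..<s} \<subseteq> occ"
    proof (intro iffI conjI)
      assume s: "s \<in> ahead \<and> (\<forall>t\<in>ahead. s \<le> t)"
      show "{max 1 (a - k)..<s} \<subseteq> occ"
      proof
        fix t assume t: "t \<in> {max 1 (a - k)..<s}"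
        show "t \<in> occ"
        proof (rule ccontr)
          assume t': "t \<notin> occ"
          \<comment> \<open>An empty spot of the interval would either be reachable by backing up or
            be an empty spot ahead that precedes the minimum \<open>s\<close>.\<close>
          then consider "t < a" | "a < t" using 3(1) by (metis linorder_neqE_nat)
          then show False
          proof cases
            case 1
            with t t' have "t \<in> behind" by (auto simp: behind_def)
            with 3(2) show False by simp
          next
            case 2
            with t t' s have "t \<in> ahead" by (auto simp: ahead_def)
            with s t show False by auto
          qed
        qed
      qed
    next
      assume s: "s \<notin> occ \<and> a < s \<and> s \<le> n \<and> {max 1 (a - k)..<s} \<subseteq> occ"
      show "\<forall>t\<in>ahead. s \<le> t"
      proof
        fix t assume "t \<in> ahead"
        then have "a < t" "t \<notin> occ" by (auto simp: ahead_def)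
        with s assms have "\<not> t < s" by (auto simp: subset_iff)
        then show "s \<le> t" by simp
      qed
    qed (auto simp: ahead_def)
    ultimately show ?thesis
      using 3 unfolding spot by (auto split: if_splits)
  qed
qed

lemma naples_spot_Some_empty:
  assumes "1 \<le> a" "naples_spot n k occ a = Some s" "a \<le> n"
  shows "s \<notin> occ" "s \<in> {1..n}"
  using assms by (auto simp: naples_spot_eq_Some_iff)

section \<open>Maximal blocks to the left and right of an entry\<close>

text \<open>The last clause is maximality: the entry just before the block stops it. Its guard
  ensures that this entry has a position of at least 1.\<close>

lemma left_len_props:
  assumes "1 \<le> i"
  shows "left_len i \<sigma> \<le> i - 1"
    and "\<And>t. i - left_len i \<sigma> \<le> t \<Longrightarrow> t < i \<Longrightarrow> \<sigma> t < \<sigma> i"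
    and "left_len i \<sigma> < i - 1 \<Longrightarrow> \<sigma> i \<le> \<sigma> (i - left_len i \<sigma> - 1)"
proof -
  define S where "S = {i - j | j. 1 \<le> j \<and> j \<le> i \<and> (\<forall>t. j \<le> t \<and> t < i \<longrightarrow> \<sigma> t < \<sigma> i)}"
  have L: "left_len i \<sigma> = Max S" by (simp add: left_len_def S_def)
  have fin: "finite S" by (rule finite_subset[of _ "{..i}"]) (auto simp: S_def)
  have "0 \<in> S" using assms by (auto simp: S_def intro!: exI[of _ i])
  with fin have "left_len i \<sigma> \<in> S" unfolding L by (intro Max_in) auto
  then obtain j where j: "left_len i \<sigma> = i - j" "1 \<le> j" "j \<le> i"
    "\<And>t. j \<le> t \<Longrightarrow> t < i \<Longrightarrow> \<sigma> t < \<sigma> i"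
    unfolding S_def by blast
  then show "left_len i \<sigma> \<le> i - 1" by simp
  show "\<sigma> t < \<sigma> i" if "i - left_len i \<sigma> \<le> t" "t < i" for t
    using j that by simp
  show "\<sigma> i \<le> \<sigma> (i - left_len i \<sigma> - 1)" if less: "left_len i \<sigma> < i - 1"
  proof (rule ccontr)
    assume "\<not> \<sigma> i \<le> \<sigma> (i - left_len i \<sigma> - 1)"
    then have lt: "\<sigma> (j - 1) < \<sigma> i" using j by simp
    have "\<sigma> t < \<sigma> i" if "j - 1 \<le> t" "t < i" for t
      using j(4)[of t] lt that by (cases "t = j - 1") auto
    moreover have "1 \<le> j - 1" "j - 1 \<le> i" using less j by auto
    ultimately have "i - (j - 1) \<in> S" unfolding S_def by blast
    with fin have "i - (j - 1) \<le> left_len i \<sigma>" unfolding L by simp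
    with j show False by simp
  qed
qed

text \<open>A maximal block stops at position \<open>i + k\<close>, at the end of the street, or
  before a larger entry. The last clause derives the third reason by excluding the first
  two.\<close>

lemma right_len_props:
  assumes "i \<le> n"
  shows "1 \<le> right_len n k i \<sigma>"
    and "right_len n k i \<sigma> \<le> k + 1"
    and "i + right_len n k i \<sigma> \<le> n + 1"
    and "\<And>t. i \<le> t \<Longrightarrow> t < i + right_len n k i \<sigma> \<Longrightarrow> \<sigma> t \<le> \<sigma> i"
    and "right_len n k i \<sigma> \<le> k \<Longrightarrow> i + right_len n k i \<sigma> \<le> n \<Longrightarrow>
           \<sigma> i < \<sigma> (i + right_len n k i \<sigma>)"
proof -
  define S where "S = {r - i + 1 | r. i \<le> r \<and> r \<le> i + k \<and> r \<le> n \<and>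
    (\<forall>t. i \<le> t \<and> t \<le> r \<longrightarrow> \<sigma> t \<le> \<sigma> i)}"
  have R: "right_len n k i \<sigma> = Max S" by (simp add: right_len_def S_def)
  have fin: "finite S" by (rule finite_subset[of _ "{..k + 1}"]) (auto simp: S_def)
  have "i - i + 1 \<in> S" unfolding S_def using assms by (fastforce dest: le_antisym)
  with fin have "right_len n k i \<sigma> \<in> S" unfolding R by (intro Max_in) auto
  then obtain r where r: "right_len n k i \<sigma> = r - i + 1" "i \<le> r" "r \<le> i + k" "r \<le> n"
    "\<And>t. i \<le> t \<Longrightarrow> t \<le> r \<Longrightarrow> \<sigma> t \<le> \<sigma> i"
    unfolding S_def by blast
  then show "1 \<le> right_len n k i \<sigma>" "right_len n k i \<sigma> \<le> k + 1"
    "i + right_len n k i \<sigma> \<le> n + 1" by simp_all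
  show "\<sigma> t \<le> \<sigma> i" if "i \<le> t" "t < i + right_len n k i \<sigma>" for t
    using r that by simp
  show "\<sigma> i < \<sigma> (i + right_len n k i \<sigma>)"
    if le: "right_len n k i \<sigma> \<le> k" "i + right_len n k i \<sigma> \<le> n"
  proof (rule ccontr)
    assume "\<not> \<sigma> i < \<sigma> (i + right_len n k i \<sigma>)"
    then have "\<sigma> (r + 1) \<le> \<sigma> i" using r by simp
    then have "\<sigma> t \<le> \<sigma> i" if "i \<le> t" "t \<le> r + 1" for t
      using r(5)[of t] that by (cases "t = r + 1") auto
    moreover have "i \<le> r + 1" "r + 1 \<le> i + k" "r + 1 \<le> n" using le r by auto
    ultimately have "r + 1 - i + 1 \<in> S" unfolding S_def by blast
    with fin have "r + 1 - i + 1 \<le> right_len n k i \<sigma>" unfolding R by simp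
    with r show False by simp
  qed
qed

section \<open>The interval of preferences leading to a given spot\<close>

text \<open>The preferences that lead car \<open>\<sigma> i\<close> to spot \<open>i\<close>.\<close>

definition pref_range :: "nat \<Rightarrow> nat \<Rightarrow> (nat \<Rightarrow> nat) \<Rightarrow> nat \<Rightarrow> nat set" where
  "pref_range n k \<sigma> i = {i + right_len n k i \<sigma> - ell n k i \<sigma>..<i + right_len n k i \<sigma>}"

text \<open>Strictness keeps the lower end of \<open>pref_range\<close> at least 1, so its natural
  subtraction does not truncate and the interval has exactly \<open>ell\<close> elements.\<close>

lemma ell_le:
  assumes "1 \<le> i"
  shows "ell n k i \<sigma> < i + right_len n k i \<sigma>"
  using left_len_props(1)[OF assms, of \<sigma>] assms by (auto simp: ell_def)

lemma pref_range_subset: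
  assumes "i \<in> {1..n}"
  shows "pref_range n k \<sigma> i \<subseteq> {1..n}"
  using ell_le[of i n k \<sigma>] right_len_props(3)[of i n k \<sigma>] assms
  by (auto simp: pref_range_def)

text \<open>Parking directly or backing up into \<open>i\<close> accounts for the
  \<open>right_len\<close> preferences from \<open>i\<close> upwards. Going forward to
  \<open>i\<close> requires the left block to contain \<open>a\<close> and all spots up to
  \<open>k\<close> behind it. If the block reaches spot 1, each of its spots qualifies; otherwise
  its first \<open>k\<close> spots drop out, which gives the two cases of
  \<open>ell\<close>.\<close>

lemma naples_spot_eq_iff_pref_range:
  assumes \<sigma>: "\<sigma> permutes {1..n}" and i: "i \<in> {1..n}" and a: "a \<in> {1..n}"
  shows "naples_spot n k {t \<in> {1..n}. \<sigma> t < \<sigma> i} a = Some i \<longleftrightarrow> a \<in> pref_range n k \<sigma> i"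
proof -
  define L where "L = left_len i \<sigma>"
  define R where "R = right_len n k i \<sigma>"
  have i1: "1 \<le> i" and "i \<le> n" using i by auto
  note L = left_len_props[OF i1, where \<sigma> = \<sigma>, folded L_def]
  note R = right_len_props[OF \<open>i \<le> n\<close>, where k = k and \<sigma> = \<sigma>, folded R_def]
  \<comment> \<open>A permutation has no ties, so the weak inequalities of \<open>right_len\<close>
    are strict away from \<open>i\<close>.\<close>
  have inj: "\<sigma> t < \<sigma> i \<longleftrightarrow> \<sigma> t \<le> \<sigma> i \<and> t \<noteq> i" for t
    using permutes_inj[OF \<sigma>] by (metis injD le_neq_implies_less less_imp_le nat_neq_iff)
  have mem: "a \<in> pref_range n k \<sigma> i \<longleftrightarrow>
      i \<le> a \<and> a < i + R \<or> a < i \<and> i \<le> a + L \<and> (L = i - 1 \<or> i + k \<le> a + L)"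
    using i1 L(1) R(1) a by (auto simp: pref_range_def ell_def L_def[symmetric] R_def[symmetric])
  have behind: "i < a \<and> a \<le> i + k \<and> {i<..a} \<subseteq> {t \<in> {1..n}. \<sigma> t < \<sigma> i} \<longleftrightarrow> i < a \<and> a < i + R"
  proof (intro iffI conjI)
    assume *: "i < a \<and> a \<le> i + k \<and> {i<..a} \<subseteq> {t \<in> {1..n}. \<sigma> t < \<sigma> i}"
    show "a < i + R"
    proof (rule ccontr)
      assume "\<not> a < i + R"
      \<comment> \<open>The spot just after the right block would be passed while backing up, yet it
        holds a larger and thus later car.\<close>
      then have "i + R \<in> {i<..a}" "R \<le> k" "i + R \<le> n" using * R(1) a by auto
      with * have "\<sigma> (i + R) < \<sigma> i" by blast
      with R(5) \<open>R \<le> k\<close> \<open>i + R \<le> n\<close> show False by simp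
    qed
  next
    assume "i < a \<and> a < i + R"
    then show "{i<..a} \<subseteq> {t \<in> {1..n}. \<sigma> t < \<sigma> i}"
      using R(4) a by (auto simp: inj)
  qed (use R(2) in auto)
  have ahead: "a < i \<and> {max 1 (a - k)..<i} \<subseteq> {t \<in> {1..n}. \<sigma> t < \<sigma> i} \<longleftrightarrow>
      a < i \<and> i \<le> a + L \<and> (L = i - 1 \<or> i + k \<le> a + L)"
  proof (intro iffI conjI)
    assume *: "a < i \<and> {max 1 (a - k)..<i} \<subseteq> {t \<in> {1..n}. \<sigma> t < \<sigma> i}"
    \<comment> \<open>Otherwise the spot just before the left block would lie in the interval,
      although by maximality it does not hold an earlier car.\<close>
    have **: "L = i - 1 \<or> i - L - 1 < max 1 (a - k)"
    proof (rule ccontr)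
      assume "\<not> ?thesis"
      then have "i - L - 1 \<in> {max 1 (a - k)..<i}" "L < i - 1" using L(1) i1 by auto
      with * L(3) show False by (fastforce simp: subset_iff)
    qed
    then show "i \<le> a + L" using * a L(1) by auto
    from ** show "L = i - 1 \<or> i + k \<le> a + L" using * a L(1) by auto
  next
    assume *: "a < i \<and> i \<le> a + L \<and> (L = i - 1 \<or> i + k \<le> a + L)"
    \<comment> \<open>Either the block begins at spot 1, or it reaches back at least to
      \<open>a - k\<close>.\<close>
    then have "i - L \<le> max 1 (a - k)" by auto
    then show "{max 1 (a - k)..<i} \<subseteq> {t \<in> {1..n}. \<sigma> t < \<sigma> i}"
      using L(2) i by auto
  qed auto
  have "naples_spot n k {t \<in> {1..n}. \<sigma> t < \<sigma> i} a = Some i \<longleftrightarrow>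
      i = a \<or> i < a \<and> a < i + R \<or> a < i \<and> i \<le> a + L \<and> (L = i - 1 \<or> i + k \<le> a + L)"
    using a i by (subst naples_spot_eq_Some_iff) (simp, use behind ahead in auto)
  then show ?thesis
    unfolding mem using R(1) by auto
qed

section \<open>Evolution of the street\<close>

lemma naples_street_range:
  assumes "\<alpha> \<in> parking_preferences n" "i \<le> n" "naples_street n k \<alpha> i s = Some c"
  shows "s \<in> {1..n} \<and> c \<in> {1..i}"
  using assms(2,3)
proof (induction i)
  case (Suc i)
  have "\<alpha> (Suc i) \<in> {1..n}" using assms(1) Suc.prems by (auto simp: parking_preferences_def PiE_iff)
  then have spot: "t \<in> {1..n}" if "naples_spot n k occ (\<alpha> (Suc i)) = Some t" for occ t
    using naples_spot_Some_empty(2)[OF _ that] by simp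
  have "naples_street n k \<alpha> i s = Some c \<or> c = Suc i \<and> s \<in> {1..n}"
    using Suc.prems spot by (auto simp: Let_def split: option.splits if_splits)
  then show ?case
  proof
    assume "naples_street n k \<alpha> i s = Some c"
    then show ?thesis using Suc.IH Suc.prems(1) by simp
  qed simp
qed simp

text \<open>Parked cars never move and later cars take only empty spots. Hence every earlier street
  can be recovered from a later one by keeping the cars that had arrived.\<close>

lemma naples_street_restrict:
  assumes \<alpha>: "\<alpha> \<in> parking_preferences n" and "i \<le> j" "j \<le> n"
  shows "naples_street n k \<alpha> i s = Some c \<longleftrightarrow> naples_street n k \<alpha> j s = Some c \<and> c \<le> i"
  using assms(2,3)
proof (induction j rule: dec_induct)
  case base
  then show ?case using naples_street_range[OF \<alpha>, of i k s c] by auto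
next
  case (step j)
  have "\<alpha> (Suc j) \<in> {1..n}" using \<alpha> step by (auto simp: parking_preferences_def PiE_iff)
  with step naples_spot_Some_empty(1)[of "\<alpha> (Suc j)" n k "dom (naples_street n k \<alpha> j)"] show ?case
    by (fastforce simp: Let_def split: option.splits if_splits)
qed

text \<open>The street after \<open>i\<close> arrivals when the final outcome is \<open>\<sigma>\<close>.\<close>

definition street_of :: "nat \<Rightarrow> (nat \<Rightarrow> nat) \<Rightarrow> nat \<Rightarrow> (nat \<rightharpoonup> nat)" where
  "street_of n \<sigma> i s = (if s \<in> {1..n} \<and> \<sigma> s \<le> i then Some (\<sigma> s) else None)"

text \<open>The bound \<open>Suc i\<close> is the next car: if that car is
  \<open>\<sigma> s\<close>, this is the occupied set in
  \<open>naples_spot_eq_iff_pref_range\<close>.\<close>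

lemma dom_street_of: "dom (street_of n \<sigma> i) = {t \<in> {1..n}. \<sigma> t < Suc i}"
  by (auto simp: street_of_def dom_def)

text \<open>Induction over arrivals: once the earlier cars stand as \<sigma> prescribes, the
  interval condition sends the next car to its spot under \<sigma>.\<close>

lemma naples_street_eq_street_of:
  assumes \<sigma>: "\<sigma> permutes {1..n}"
    and pref: "\<And>i. i \<in> {1..n} \<Longrightarrow> \<alpha> (\<sigma> i) \<in> pref_range n k \<sigma> i"
    and "i \<le> n"
  shows "naples_street n k \<alpha> i = street_of n \<sigma> i"
  using \<open>i \<le> n\<close>
proof (induction i)
  case 0
  have "\<sigma> s \<in> {1..n}" if "s \<in> {1..n}" for s using permutes_in_image[OF \<sigma>] that by simp
  then show ?case by (fastforce simp: street_of_def)
next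
  case (Suc i)
  define s where "s = inv \<sigma> (Suc i)"
  have s: "s \<in> {1..n}" "\<sigma> s = Suc i"
    using Suc.prems permutes_in_image[OF permutes_inv[OF \<sigma>]] permutes_inverses[OF \<sigma>]
    by (auto simp: s_def)
  have "naples_spot n k {t \<in> {1..n}. \<sigma> t < \<sigma> s} (\<alpha> (\<sigma> s)) = Some s"
    using naples_spot_eq_iff_pref_range[OF \<sigma> s(1)] pref[OF s(1)] pref_range_subset[OF s(1), of k \<sigma>]
    by blast
  then have "naples_street n k \<alpha> (Suc i) = (street_of n \<sigma> i)(s \<mapsto> Suc i)"
    using Suc s by (simp add: dom_street_of)
  also have "\<dots> = street_of n \<sigma> (Suc i)"
  proof
    fix t
    \<comment> \<open>By injectivity, raising the bound from \<open>i\<close> to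
      \<open>Suc i\<close> adds only the spot \<open>s\<close>.\<close>
    have "\<sigma> t \<noteq> Suc i" if "t \<noteq> s" using permutes_inj[OF \<sigma>] s(2) that by (metis injD)
    then show "((street_of n \<sigma> i)(s \<mapsto> Suc i)) t = street_of n \<sigma> (Suc i) t"
      using s by (cases "t = s") (simp_all add: street_of_def le_Suc_eq)
  qed
  finally show ?case .
qed

section \<open>Fibres of the outcome map\<close>

text \<open>By counting: \<open>n\<close> parked cars need at least \<open>n\<close> spots, so every
  spot is filled, and a surjection of \<open>{1..n}\<close> onto itself is a bijection.\<close>

lemma PF_outcome:
  assumes "\<alpha> \<in> PF n k"
  defines "\<sigma> \<equiv> naples_outcome n k \<alpha>"
  shows "\<sigma> permutes {1..n}"
    and "i \<in> {1..n} \<Longrightarrow> naples_street n k \<alpha> n i = Some (\<sigma> i)"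
proof -
  let ?st = "naples_street n k \<alpha> n"
  have \<alpha>: "\<alpha> \<in> parking_preferences n" and all: "\<And>c. c \<in> {1..n} \<Longrightarrow> \<exists>s. ?st s = Some c"
    using assms by (auto simp: PF_def)
  note range = naples_street_range[OF \<alpha> order_refl, of k]
  have dom: "dom ?st \<subseteq> {1..n}" using range by auto
  have image: "(\<lambda>s. the (?st s)) ` dom ?st = {1..n}"
  proof (intro equalityI subsetI)
    fix c assume "c \<in> {1..n}"
    then obtain s where "?st s = Some c" using all by blast
    then show "c \<in> (\<lambda>s. the (?st s)) ` dom ?st" by (force intro: image_eqI[of _ _ s])
  next
    fix c assume "c \<in> (\<lambda>s. the (?st s)) ` dom ?st"
    then obtain s where "?st s = Some c" by auto
    then show "c \<in> {1..n}" using range by blast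
  qed
  have "n \<le> card (dom ?st)"
    using card_image_le[of "dom ?st" "\<lambda>s. the (?st s)"] dom
    unfolding image by (auto intro: finite_subset)
  then have dom_eq: "dom ?st = {1..n}"
    using dom by (intro card_seteq) auto
  show st: "?st i = Some (\<sigma> i)" if "i \<in> {1..n}" for i
    using that dom_eq unfolding \<sigma>_def naples_outcome_def
    by (metis domIff not_None_eq option.simps(5))
  have "\<sigma> ` {1..n} = (\<lambda>s. the (?st s)) ` {1..n}"
    by (intro image_cong) (simp_all add: st)
  then have "\<sigma> ` {1..n} = {1..n}"
    using image unfolding dom_eq by simp
  then have "bij_betw \<sigma> {1..n} {1..n}"
    by (simp add: bij_betw_def eq_card_imp_inj_on)
  \<comment> \<open>Here the default value of \<open>naples_outcome\<close> in the
    \<open>None\<close> case applies.\<close>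
  moreover have "\<sigma> i = i" if "i \<notin> {1..n}" for i
    using that range unfolding \<sigma>_def naples_outcome_def by (auto split: option.splits)
  ultimately show "\<sigma> permutes {1..n}"
    by (rule bij_imp_permutes)
qed

text \<open>Converse of \<open>naples_street_eq_street_of\<close>. By
  \<open>naples_street_restrict\<close>, the street at every time can be read off the outcome; apply
  this just before and just after car \<open>\<sigma> i\<close> arrives.\<close>

lemma PF_pref_range:
  assumes "\<alpha> \<in> PF n k" and i: "i \<in> {1..n}"
  defines "\<sigma> \<equiv> naples_outcome n k \<alpha>"
  shows "\<alpha> (\<sigma> i) \<in> pref_range n k \<sigma> i"
proof -
  have \<alpha>: "\<alpha> \<in> parking_preferences n" using assms by (auto simp: PF_def)
  note \<sigma> = PF_outcome[OF assms(1), folded \<sigma>_def]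
  have c: "\<sigma> i \<in> {1..n}" using permutes_in_image[OF \<sigma>(1)] i by simp
  define j where "j = \<sigma> i - 1"
  have j: "Suc j = \<sigma> i" "Suc j \<le> n" using c by (auto simp: j_def)
  have eq: "naples_street n k \<alpha> m s = Some d \<longleftrightarrow> s \<in> {1..n} \<and> d = \<sigma> s \<and> d \<le> m"
    if "m \<le> n" for m s d
  proof -
    have "naples_street n k \<alpha> n s = Some d \<longleftrightarrow> s \<in> {1..n} \<and> d = \<sigma> s"
      using \<sigma>(2)[of s] naples_street_range[OF \<alpha> order_refl, of k s d] by fastforce
    then show ?thesis
      using naples_street_restrict[OF \<alpha> that order_refl, of k s d] by blast
  qed
  have dom: "dom (naples_street n k \<alpha> j) = {t \<in> {1..n}. \<sigma> t < \<sigma> i}"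
    using j by (auto simp: dom_def eq)
  have "naples_street n k \<alpha> (Suc j) i = Some (Suc j)"
    using j i by (subst eq) auto
  moreover have "naples_street n k \<alpha> j i \<noteq> Some (Suc j)"
    using j by (subst eq) auto
  \<comment> \<open>The car stands at \<open>i\<close> after its arrival but not before, so this
    arrival placed it there.\<close>
  ultimately have "naples_spot n k (dom (naples_street n k \<alpha> j)) (\<alpha> (Suc j)) = Some i"
    by (auto simp: Let_def split: option.splits if_splits)
  then have "naples_spot n k {t \<in> {1..n}. \<sigma> t < \<sigma> i} (\<alpha> (\<sigma> i)) = Some i"
    unfolding dom j(1) .
  then show ?thesis
    using \<alpha> c by (subst (asm) naples_spot_eq_iff_pref_range[OF \<sigma>(1) i])
      (auto simp: parking_preferences_def PiE_iff)
qed

text \<open>Preferences are indexed by cars and intervals by spots; \<open>inv \<sigma>\<close>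
  translates. The fibre is a full product because each constraint involves only one car.\<close>

lemma PF_fibre:
  assumes \<sigma>: "\<sigma> permutes {1..n}"
  shows "{\<alpha> \<in> PF n k. naples_outcome n k \<alpha> = \<sigma>} =
    (\<Pi>\<^sub>E c\<in>{1..n}. pref_range n k \<sigma> (inv \<sigma> c))"
proof (intro equalityI subsetI)
  fix \<alpha> assume "\<alpha> \<in> {\<alpha> \<in> PF n k. naples_outcome n k \<alpha> = \<sigma>}"
  then have \<alpha>: "\<alpha> \<in> PF n k" "naples_outcome n k \<alpha> = \<sigma>" by auto
  have "\<alpha> c \<in> pref_range n k \<sigma> (inv \<sigma> c)" if "c \<in> {1..n}" for c
    using PF_pref_range[OF \<alpha>(1), of "inv \<sigma> c"] that permutes_inverses[OF \<sigma>]
      permutes_in_image[OF permutes_inv[OF \<sigma>]] by (simp add: \<alpha>(2))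
  then show "\<alpha> \<in> (\<Pi>\<^sub>E c\<in>{1..n}. pref_range n k \<sigma> (inv \<sigma> c))"
    using \<alpha>(1) by (auto simp: PF_def parking_preferences_def PiE_iff)
next
  fix \<alpha> assume \<alpha>: "\<alpha> \<in> (\<Pi>\<^sub>E c\<in>{1..n}. pref_range n k \<sigma> (inv \<sigma> c))"
  have "\<alpha> (\<sigma> i) \<in> pref_range n k \<sigma> i" if "i \<in> {1..n}" for i
    using PiE_mem[OF \<alpha>, of "\<sigma> i"] that permutes_inverses[OF \<sigma>] permutes_in_image[OF \<sigma>] by simp
  from naples_street_eq_street_of[OF \<sigma> this order_refl]
  have st: "naples_street n k \<alpha> n = street_of n \<sigma> n" .
  have le: "\<sigma> s \<le> n" if "s \<in> {1..n}" for s
    using permutes_in_image[OF \<sigma>] that by (metis atLeastAtMost_iff)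
  have inv: "inv \<sigma> c \<in> {1..n}" if "c \<in> {1..n}" for c
    using permutes_in_image[OF permutes_inv[OF \<sigma>]] that by simp
  have "\<alpha> \<in> parking_preferences n"
    using \<alpha> inv pref_range_subset unfolding parking_preferences_def PiE_iff by blast
  moreover have "naples_street n k \<alpha> n (inv \<sigma> c) = Some c" if "c \<in> {1..n}" for c
    using that inv[OF that] permutes_inverses[OF \<sigma>] by (simp add: st street_of_def)
  ultimately have "\<alpha> \<in> PF n k" unfolding PF_def by blast
  moreover have "naples_outcome n k \<alpha> = \<sigma>"
    using le permutes_not_in[OF \<sigma>] by (fastforce simp: naples_outcome_def st street_of_def)
  ultimately show "\<alpha> \<in> {\<alpha> \<in> PF n k. naples_outcome n k \<alpha> = \<sigma>}" by simp
qed

section \<open>The area and the generating function\<close>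

text \<open>Term \<open>i\<close> of the area mixes data of spot \<open>i\<close> with the
  preference of car \<open>i\<close>. Only totals matter, so the spot part is reindexed by
  \<open>inv \<sigma>\<close>, pairing each preference with the maximum of its own interval. The
  differences become natural numbers, so ordinary powers of \<open>q\<close> suffice.\<close>

lemma naples_area_eq:
  assumes "\<alpha> \<in> PF n k"
  defines "\<sigma> \<equiv> naples_outcome n k \<alpha>"
  shows "naples_area n k \<alpha> =
    int (\<Sum>c=1..n. inv \<sigma> c + right_len n k (inv \<sigma> c) \<sigma> - 1 - \<alpha> c)"
proof -
  note \<sigma> = PF_outcome(1)[OF assms(1), folded \<sigma>_def]
  let ?r = "\<lambda>i. right_len n k i \<sigma>"
  have reflect: "(\<Sum>i=1..n. int n - int i) = (\<Sum>i=1..n. int i - 1)"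
    by (rule sum.reindex_bij_witness[of _ "\<lambda>i. n + 1 - i" "\<lambda>i. n + 1 - i"]) auto
  have "naples_area n k \<alpha> = (\<Sum>i=1..n. int n - int i) + (\<Sum>i=1..n. int (?r i)) - (\<Sum>c=1..n. int (\<alpha> c))"
    by (simp add: naples_area_def \<sigma>_def sum.distrib sum_subtractf)
  also have "\<dots> = (\<Sum>i=1..n. int i + int (?r i) - 1) - (\<Sum>c=1..n. int (\<alpha> c))"
    unfolding reflect by (simp add: sum.distrib sum_subtractf)
  also have "(\<Sum>i=1..n. int i + int (?r i) - 1) = (\<Sum>c=1..n. int (inv \<sigma> c) + int (?r (inv \<sigma> c)) - 1)"
    using sum.permute[OF permutes_inv[OF \<sigma>], of "\<lambda>i. int i + int (?r i) - 1"] by (simp add: o_def)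
  also have "\<dots> - (\<Sum>c=1..n. int (\<alpha> c)) =
      (\<Sum>c=1..n. int (inv \<sigma> c + ?r (inv \<sigma> c) - 1 - \<alpha> c))"
    unfolding sum_subtractf[symmetric]
  proof (rule sum.cong)
    fix c assume c: "c \<in> {1..n}"
    \<comment> \<open>Membership in the interval keeps each preference at or below its maximum, so
      natural subtraction is exact.\<close>
    have "\<alpha> \<in> (\<Pi>\<^sub>E c\<in>{1..n}. pref_range n k \<sigma> (inv \<sigma> c))"
      using PF_fibre[OF \<sigma>, of k] assms by auto
    from PiE_mem[OF this c]
    show "int (inv \<sigma> c) + int (?r (inv \<sigma> c)) - 1 - int (\<alpha> c) =
        int (inv \<sigma> c + ?r (inv \<sigma> c) - 1 - \<alpha> c)"
      by (auto simp: pref_range_def)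
  qed simp
  finally show ?thesis by simp
qed

text \<open>Distances from the maximum of the interval run once through \<open>0\<close>, ...,
  \<open>ell - 1\<close>.\<close>

lemma sum_pref_range:
  assumes "1 \<le> i"
  shows "(\<Sum>a\<in>pref_range n k \<sigma> i. fls_X ^ (i + right_len n k i \<sigma> - 1 - a)) = q_int (ell n k i \<sigma>)"
proof -
  let ?m = "i + right_len n k i \<sigma>"
  show ?thesis unfolding q_int_def pref_range_def
    by (rule sum.reindex_bij_witness[of _ "\<lambda>j. ?m - 1 - j" "\<lambda>a. ?m - 1 - a"])
      (use ell_le[OF assms, of n k \<sigma>] in auto)
qed

theorem proposition5p9:
  fixes n k :: nat
  assumes "1 \<le> n" and "k \<le> n - 1"
  shows "(\<Sum>\<sigma> | \<sigma> permutes {1..n}. \<Prod>i=1..n. q_int (ell n k i \<sigma>))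
       = (\<Sum>\<alpha>\<in>PF n k. fls_X_intpow (naples_area n k \<alpha>))"
proof -
  let ?e = "\<lambda>\<sigma> c a. inv \<sigma> c + right_len n k (inv \<sigma> c) \<sigma> - 1 - a"
  have fin: "finite (PF n k)"
    by (rule finite_subset[of _ "parking_preferences n"])
      (auto simp: PF_def parking_preferences_def intro: finite_PiE)
  have fibre: "(\<Sum>\<alpha> | \<alpha> \<in> PF n k \<and> naples_outcome n k \<alpha> = \<sigma>. fls_X_intpow (naples_area n k \<alpha>))
      = (\<Prod>i=1..n. q_int (ell n k i \<sigma>))" if \<sigma>: "\<sigma> permutes {1..n}" for \<sigma>
  proof -
    have inv: "inv \<sigma> c \<in> {1..n}" if "c \<in> {1..n}" for c
      using permutes_in_image[OF permutes_inv[OF \<sigma>]] that by simp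
    have "(\<Sum>\<alpha> | \<alpha> \<in> PF n k \<and> naples_outcome n k \<alpha> = \<sigma>. fls_X_intpow (naples_area n k \<alpha>))
        = (\<Sum>\<alpha> | \<alpha> \<in> PF n k \<and> naples_outcome n k \<alpha> = \<sigma>. \<Prod>c=1..n. fls_X ^ ?e \<sigma> c (\<alpha> c))"
    proof (rule sum.cong)
      fix \<alpha> assume "\<alpha> \<in> {\<alpha> \<in> PF n k. naples_outcome n k \<alpha> = \<sigma>}"
      then have "naples_area n k \<alpha> = int (\<Sum>c=1..n. ?e \<sigma> c (\<alpha> c))"
        using naples_area_eq[of \<alpha> n k] by simp
      then show "fls_X_intpow (naples_area n k \<alpha>) = (\<Prod>c=1..n. fls_X ^ ?e \<sigma> c (\<alpha> c))"
        by (simp only: fls_X_power_conv_shift_1[symmetric] power_sum[symmetric])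
    qed simp
    also have "\<dots> = (\<Prod>c=1..n. \<Sum>a\<in>pref_range n k \<sigma> (inv \<sigma> c). fls_X ^ ?e \<sigma> c a)"
      \<comment> \<open>Distributivity: a sum over the product set of a product of one-car weights
        factors into one sum per car.\<close>
      unfolding PF_fibre[OF \<sigma>] by (rule prod_sum_PiE[symmetric]) (auto simp: pref_range_def)
    also have "\<dots> = (\<Prod>c=1..n. q_int (ell n k (inv \<sigma> c) \<sigma>))"
      using inv by (intro prod.cong sum_pref_range) auto
    also have "\<dots> = (\<Prod>i=1..n. q_int (ell n k i \<sigma>))"
      using prod.permute[OF permutes_inv[OF \<sigma>], of "\<lambda>i. q_int (ell n k i \<sigma>)"] by (simp add: o_def)
    finally show ?thesis .
  qed
  have "(\<Sum>\<alpha>\<in>PF n k. fls_X_intpow (naples_area n k \<alpha>)) =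
      (\<Sum>\<sigma> | \<sigma> permutes {1..n}. \<Sum>\<alpha> | \<alpha> \<in> PF n k \<and> naples_outcome n k \<alpha> = \<sigma>.
        fls_X_intpow (naples_area n k \<alpha>))"
    \<comment> \<open>Outcomes are permutations, so the fibres over all \<sigma> partition
      \<open>PF n k\<close>.\<close>
    using fin PF_outcome(1) by (intro sum.group[symmetric]) (auto simp: finite_permutations)
  also have "\<dots> = (\<Sum>\<sigma> | \<sigma> permutes {1..n}. \<Prod>i=1..n. q_int (ell n k i \<sigma>))"
    by (intro sum.cong) (auto simp: fibre)
  finally show ?thesis by simp
qed

end
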